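(* For every bounded metric space $Z$, $\operatorname{asdim}\operatorname{Co}(Z)\le\operatorname{cdim}Z+1$.
   Context: Hyperbolic cone: if $\operatorname{diam}Z>0$, put $\mu=\pi/\operatorname{diam}Z$; $\operatorname{Co}(Z)$ is $Z\times[0,\infty)/(Z\times\{0\})$ with the metric: for $x=(z,t)$, $x'=(z',t')$, $|xx'|$ is the length of the side $\bar x\bar x'$ of a triangle $\bar o\bar x\bar x'$ in the hyperbolic plane $\mathrm H^2$ with $|\bar o\bar x|=t$, $|\bar o\bar x'|=t'$ and angle $\mu|zz'|$ at $\bar o$. If $Z$ is a point, $\operatorname{Co}(Z)=[0,\infty)$. Asymptotic dimension: $\operatorname{asdim}X$ is the minimal $n$ such that for every $\lambda>0$ there is a $\lambda$-Lipschitz map $f:X\to P$ to a uniform simplicial polyhedron $P$ of dimension $\le n$ with $\sup_\sigma\operatorname{diam}f^{-1}(\sigma)<\infty$ over simplices $\sigma$ of $P$; a uniform polyhedron is a simplicial polyhedron isometric to a subcomplex of $\Delta^J=\{x\in\mathbb R^J:x_j\ge0,\sum x_j=1\}$, $\mathbb R^J$ the finitely supported functions $J\to\mathbb R$ with $\ell^2$ distance. Capacity dimension: for an open covering $\mathcal U$ of $Z$ let $\operatorname{mesh}(\mathcal U,z)=\sup\{\operatorname{diam}U:z\in U\in\mathcal U\}$, $\operatorname{mesh}(\mathcal U)=\sup_U\operatorname{diam}U$, $L(\mathcal U,z)=\min\{\sup_{U\in\mathcal U}\operatorname{dist}(z,Z\setminus U),\operatorname{mesh}(\mathcal U,z)\}$,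 $L(\mathcal U)=\inf_zL(\mathcal U,z)$, $\operatorname{cap}(\mathcal U)=L(\mathcal U)/\operatorname{mesh}(\mathcal U)$ (set to $1$ if $\operatorname{mesh}=0$ or $L=\operatorname{mesh}=\infty$). A covering is $(m+1)$-colored if it is a union of $m+1$ subfamilies each of pairwise disjoint sets. For $\tau>0$, $\delta\in(0,1)$, integer $m\ge0$, $c_\tau(Z,m,\delta)$ is the supremum (0 if empty) of $\operatorname{cap}(\mathcal U)$ over open $(m+1)$-colored coverings with $\delta\tau\le\operatorname{mesh}(\mathcal U)\le\tau$; $c(Z,m,\delta)=\liminf_{\tau\to0}c_\tau(Z,m,\delta)$; $c(Z,m)=\lim_{\delta\to0}c(Z,m,\delta)$; $\operatorname{cdim}Z=\inf\{m:c(Z,m)>0\}$. *)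

theory Defs
  imports "HOL-Analysis.Analysis" "HOL-Library.Extended_Nat" "HOL-Library.Extended_Real"
begin

text \<open>Length of the side opposite to the angle gamma at the vertex of a triangle in the
hyperbolic plane H^2 whose two sides at that vertex have lengths a and b
(hyperbolic law of cosines).\<close>
definition hyp_side :: "real \<Rightarrow> real \<Rightarrow> real \<Rightarrow> real" where
  "hyp_side a b gamma = arcosh (cosh a * cosh b - sinh a * sinh b * cos gamma)"

text \<open>The angle factor mu = pi / diam Z (irrelevant if diam Z = 0, i.e. Z is a point).\<close>
definition cone_mu :: "'a::metric_space set \<Rightarrow> real" where
  "cone_mu Z = (if diameter Z > 0 then pi / diameter Z else 0)"

text \<open>Points of Co(Z): the vertex (class of Z x {0}) is None; (z,t) with t > 0 is Some (z,t).\<close>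
definition cone_carrier :: "'a::metric_space set \<Rightarrow> ('a \<times> real) option set" where
  "cone_carrier Z = insert None (Some ` (Z \<times> {0<..}))"

definition cone_dist :: "'a::metric_space set \<Rightarrow> ('a \<times> real) option \<Rightarrow> ('a \<times> real) option \<Rightarrow> real" where
  "cone_dist Z x y = (case (x, y) of
      (None, None) \<Rightarrow> 0
    | (None, Some (z, t)) \<Rightarrow> t
    | (Some (z, t), None) \<Rightarrow> t
    | (Some (z, t), Some (z', t')) \<Rightarrow> hyp_side t t' (cone_mu Z * dist z z'))"

definition supp_fn :: "('v \<Rightarrow> real) \<Rightarrow> 'v set" where
  "supp_fn v = {j. v j \<noteq> 0}"

definition std_simplex :: "('v \<Rightarrow> real) set" where
  "std_simplex = {v. finite (supp_fn v) \<and> (\<forall>j. 0 \<le> v j) \<and> sum v (supp_fn v) = 1}"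

definition l2_dist :: "('v \<Rightarrow> real) \<Rightarrow> ('v \<Rightarrow> real) \<Rightarrow> real" where
  "l2_dist v w = sqrt (\<Sum>j\<in>supp_fn v \<union> supp_fn w. (v j - w j)\<^sup>2)"

definition simplicial_complex :: "'v set set \<Rightarrow> bool" where
  "simplicial_complex K \<longleftrightarrow>
     (\<forall>\<sigma>\<in>K. finite \<sigma> \<and> \<sigma> \<noteq> {}) \<and> (\<forall>\<sigma>\<in>K. \<forall>\<tau>. \<tau> \<subseteq> \<sigma> \<and> \<tau> \<noteq> {} \<longrightarrow> \<tau> \<in> K)"

definition geom_simplex :: "'v set \<Rightarrow> ('v \<Rightarrow> real) set" where
  "geom_simplex \<sigma> = {v \<in> std_simplex. supp_fn v \<subseteq> \<sigma>}"

definition polyhedron :: "'v set set \<Rightarrow> ('v \<Rightarrow> real) set" where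
  "polyhedron K = (\<Union>\<sigma>\<in>K. geom_simplex \<sigma>)"

text \<open>asdim X \<le> n for a metric space given by carrier X and metric d.  The uniform polyhedra
are taken as subcomplexes of Delta^J with vertex set J of type 'b set (subsets of the space).\<close>
definition asdim_le :: "'b set \<Rightarrow> ('b \<Rightarrow> 'b \<Rightarrow> real) \<Rightarrow> nat \<Rightarrow> bool" where
  "asdim_le X d n \<longleftrightarrow>
     (\<forall>lam>0. \<exists>(K :: 'b set set set) (f :: 'b \<Rightarrow> ('b set \<Rightarrow> real)).
        simplicial_complex K \<and> (\<forall>\<sigma>\<in>K. card \<sigma> \<le> n + 1) \<and>
        (\<forall>x\<in>X. f x \<in> polyhedron K) \<and>
        (\<forall>x\<in>X. \<forall>y\<in>X. l2_dist (f x) (f y) \<le> lam * d x y) \<and>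
        (\<exists>D. \<forall>\<sigma>\<in>K. \<forall>x\<in>X. \<forall>y\<in>X.
              f x \<in> geom_simplex \<sigma> \<and> f y \<in> geom_simplex \<sigma> \<longrightarrow> d x y \<le> D))"

definition asdim :: "'b set \<Rightarrow> ('b \<Rightarrow> 'b \<Rightarrow> real) \<Rightarrow> enat" where
  "asdim X d = Inf {enat n | n. asdim_le X d n}"

definition ediam :: "'a::metric_space set \<Rightarrow> ereal" where
  "ediam U = (if U = {} then 0 else (SUP p\<in>U \<times> U. ereal (dist (fst p) (snd p))))"

definition mesh_at :: "'a::metric_space set set \<Rightarrow> 'a \<Rightarrow> ereal" where
  "mesh_at \<U> z = (SUP U\<in>{U\<in>\<U>. z \<in> U}. ediam U)"

definition mesh :: "'a::metric_space set set \<Rightarrow> ereal" where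
  "mesh \<U> = (SUP U\<in>\<U>. ediam U)"

definition dist_compl :: "'a::metric_space set \<Rightarrow> 'a \<Rightarrow> 'a set \<Rightarrow> ereal" where
  "dist_compl Z z U = (if Z - U = {} then \<infinity> else ereal (infdist z (Z - U)))"

definition leb_at :: "'a::metric_space set \<Rightarrow> 'a set set \<Rightarrow> 'a \<Rightarrow> ereal" where
  "leb_at Z \<U> z = min (SUP U\<in>\<U>. dist_compl Z z U) (mesh_at \<U> z)"

definition leb :: "'a::metric_space set \<Rightarrow> 'a set set \<Rightarrow> ereal" where
  "leb Z \<U> = (INF z\<in>Z. leb_at Z \<U> z)"

definition cap :: "'a::metric_space set \<Rightarrow> 'a set set \<Rightarrow> ereal" where
  "cap Z \<U> = (if mesh \<U> = 0 \<or> (leb Z \<U> = \<infinity> \<and> mesh \<U> = \<infinity>) then 1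
              else leb Z \<U> / mesh \<U>)"

definition open_covering :: "'a::metric_space set \<Rightarrow> 'a set set \<Rightarrow> bool" where
  "open_covering Z \<U> \<longleftrightarrow> (\<forall>U\<in>\<U>. openin (top_of_set Z) U) \<and> \<Union>\<U> = Z"

definition colored :: "nat \<Rightarrow> 'a set set \<Rightarrow> bool" where
  "colored k \<U> \<longleftrightarrow> (\<exists>col :: 'a set \<Rightarrow> nat. (\<forall>U\<in>\<U>. col U < k) \<and>
       (\<forall>U\<in>\<U>. \<forall>V\<in>\<U>. U \<noteq> V \<and> col U = col V \<longrightarrow> U \<inter> V = {}))"

definition c_tau :: "'a::metric_space set \<Rightarrow> nat \<Rightarrow> real \<Rightarrow> real \<Rightarrow> ereal" where
  "c_tau Z m \<delta> \<tau> =
     (let S = {cap Z \<U> | \<U>. open_covering Z \<U> \<and> colored (m + 1) \<U> \<and>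
                           ereal (\<delta> * \<tau>) \<le> mesh \<U> \<and> mesh \<U> \<le> ereal \<tau>}
      in if S = {} then 0 else Sup S)"

definition c_delta :: "'a::metric_space set \<Rightarrow> nat \<Rightarrow> real \<Rightarrow> ereal" where
  "c_delta Z m \<delta> = Liminf (at_right 0) (c_tau Z m \<delta>)"

definition c_cap :: "'a::metric_space set \<Rightarrow> nat \<Rightarrow> ereal" where
  "c_cap Z m = Lim (at_right 0) (c_delta Z m)"

definition cdim :: "'a::metric_space set \<Rightarrow> enat" where
  "cdim Z = Inf {enat m | m. c_cap Z m > 0}"

end

theory Submission
  imports Defs
begin

text \<open>
A cover of multiplicity at most \<open>n + 1\<close> with bounded members and large Lebesgue number yields,
through its partition of unity, a Lipschitz map with small constant to an \<open>n\<close>-dimensional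
polyhedron, so it suffices to cover the cone by such covers of multiplicity \<open>m + 2\<close>.

At height \<open>t\<close> the horizontal scale of the cone is \<open>exp (- t)\<close>. Choose \<open>(m + 1)\<close>-colored covers
\<open>\<U> k\<close> of \<open>Z\<close> whose mesh and Lebesgue number are both comparable to \<open>exp (- k * T)\<close>, so that each
cover refines the previous one through a map \<open>\<rho>\<close>, and use \<open>\<U> k\<close> at heights near \<open>k * T\<close>. On the way
from \<open>\<U> k\<close> to \<open>\<U> (k + 1)\<close>, the members of \<open>\<U> (k + 1)\<close> split off from their images under \<open>\<rho>\<close>
one color after another. At any height only one color is in transition, so the multiplicity grows
by just one; this is a simplicial mapping cylinder of \<open>\<rho>\<close> in the language of covers.
\<close>

section \<open>Asymptotic dimension from Lebesgue numbers\<close>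

text \<open>The map is the barycentric map to the nerve. Truncated distances to the complements are
  1-Lipschitz, and the Lebesgue hypothesis makes their sum at least \<open>R\<close>. After division
  by this sum every coordinate has a Lipschitz constant of order \<open>1 / R\<close>, and bounded
  multiplicity controls the number of coordinates involved.\<close>

lemma asdim_le_if_lebesgue_covers:
  fixes d :: "'b \<Rightarrow> 'b \<Rightarrow> real"
  assumes nonneg: "\<And>x y. \<lbrakk>x \<in> X; y \<in> X\<rbrakk> \<Longrightarrow> 0 \<le> d x y"
    and sym: "\<And>x y. \<lbrakk>x \<in> X; y \<in> X\<rbrakk> \<Longrightarrow> d x y = d y x"
    and refl: "\<And>x. x \<in> X \<Longrightarrow> d x x = 0"
    and tri: "\<And>x y z. \<lbrakk>x \<in> X; y \<in> X; z \<in> X\<rbrakk> \<Longrightarrow> d x z \<le> d x y + d y z"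
    and covers: "\<And>R. 0 < R \<Longrightarrow> \<exists>\<V> D.
        (\<forall>x\<in>X. finite {V\<in>\<V>. x \<in> V} \<and> card {V\<in>\<V>. x \<in> V} \<le> n + 1) \<and>
        (\<forall>V\<in>\<V>. \<forall>x\<in>X. \<forall>y\<in>X. x \<in> V \<and> y \<in> V \<longrightarrow> d x y \<le> D) \<and>
        (\<forall>x\<in>X. \<exists>V\<in>\<V>. \<forall>y\<in>X. d x y < R \<longrightarrow> y \<in> V)"
  shows "asdim_le X d n"
  unfolding asdim_le_def
proof (intro allI impI)
  fix lam :: real assume "0 < lam"
  \<comment> \<open>\<open>M\<close> bounds the number of members that contain one of two given
    points; \<open>R\<close> is then chosen so that the final Lipschitz constant
    \<open>M * (M + 1) / R\<close> equals \<open>lam\<close>.\<close>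
  define M where "M = real (2 * n + 2)"
  have "0 < M" by (simp add: M_def)
  define R where "R = M * (M + 1) / lam"
  have "0 < R" using \<open>0 < M\<close> \<open>0 < lam\<close> by (simp add: R_def)
  obtain \<V> D where cov:
        "(\<forall>x\<in>X. finite {V\<in>\<V>. x \<in> V} \<and> card {V\<in>\<V>. x \<in> V} \<le> n + 1) \<and>
        (\<forall>V\<in>\<V>. \<forall>x\<in>X. \<forall>y\<in>X. x \<in> V \<and> y \<in> V \<longrightarrow> d x y \<le> D) \<and>
        (\<forall>x\<in>X. \<exists>V\<in>\<V>. \<forall>y\<in>X. d x y < R \<longrightarrow> y \<in> V)"
    using covers[OF \<open>0 < R\<close>] by (elim exE)
  then have mult: "\<And>x. x \<in> X \<Longrightarrow> finite {V\<in>\<V>. x \<in> V}" "\<And>x. x \<in> X \<Longrightarrow> card {V\<in>\<V>. x \<in> V} \<le> n + 1"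
    and bdd: "\<And>V x y. \<lbrakk>V \<in> \<V>; x \<in> X; y \<in> X; x \<in> V; y \<in> V\<rbrakk> \<Longrightarrow> d x y \<le> D"
    and leb: "\<And>x. x \<in> X \<Longrightarrow> \<exists>V\<in>\<V>. \<forall>y\<in>X. d x y < R \<longrightarrow> y \<in> V"
    by simp_all
  define N where "N x = {V\<in>\<V>. x \<in> V}" for x
  note mult = mult[folded N_def]
  \<comment> \<open>Inserting \<open>R\<close> truncates the distance to the complement and gives
    the value \<open>R\<close> when \<open>V\<close> contains all of \<open>X\<close>.\<close>
  define \<phi> where "\<phi> V x = Inf (insert R (d x ` (X - V)))" for V x
  have bb: "bdd_below (insert R (d x ` (X - V)))" if "x \<in> X" for x V
    using nonneg that \<open>0 < R\<close> by (intro bdd_belowI[of _ 0]) auto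
  have \<phi>_nonneg: "0 \<le> \<phi> V x" if "x \<in> X" for x V
    unfolding \<phi>_def using nonneg that \<open>0 < R\<close> by (intro cInf_greatest) auto
  have \<phi>_le_dist: "\<phi> V x \<le> d x y" if "x \<in> X" "y \<in> X" "y \<notin> V" for x y V
    unfolding \<phi>_def using that bb by (intro cInf_lower) auto
  have \<phi>_le_R: "\<phi> V x \<le> R" if "x \<in> X" for x V
    unfolding \<phi>_def using that bb by (intro cInf_lower) auto
  have \<phi>_outside: "\<phi> V x = 0" if "x \<in> X" "x \<notin> V" for x V
    using \<phi>_le_dist[OF that(1,1,2)] \<phi>_nonneg[OF that(1), of V] refl[OF that(1)] by simp
  have \<phi>_lip1: "\<phi> V x - d x y \<le> \<phi> V y" if "x \<in> X" "y \<in> X" for x y V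
    unfolding \<phi>_def[of V y]
  proof (rule cInf_greatest)
    fix e assume "e \<in> insert R (d y ` (X - V))"
    then show "\<phi> V x - d x y \<le> e"
    proof
      assume "e = R"
      then show ?thesis using \<phi>_le_R[OF that(1), of V] nonneg[OF that] by simp
    next
      assume "e \<in> d y ` (X - V)"
      then obtain w where w: "w \<in> X" "w \<notin> V" "e = d y w" by blast
      then show ?thesis
        using \<phi>_le_dist[OF that(1) w(1,2)] tri[OF that w(1)] by simp
    qed
  qed simp
  have \<phi>_lip: "\<bar>\<phi> V x - \<phi> V y\<bar> \<le> d x y" if "x \<in> X" "y \<in> X" for x y V
    using \<phi>_lip1[OF that, of V] \<phi>_lip1[OF that(2,1), of V] sym[OF that] by linarith
  define S where "S x = (\<Sum>V\<in>N x. \<phi> V x)" for x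
  have S_ge: "R \<le> S x" if x: "x \<in> X" for x
  proof -
    obtain V where V: "V \<in> \<V>" "\<And>y. y \<in> X \<Longrightarrow> d x y < R \<Longrightarrow> y \<in> V"
      using leb[OF x] by blast
    have "V \<in> N x" using V that refl \<open>0 < R\<close> by (simp add: N_def)
    have "R \<le> \<phi> V x"
      unfolding \<phi>_def using V(2) by (intro cInf_greatest) (auto simp: not_less[symmetric])
    also have "\<dots> \<le> S x"
      unfolding S_def using \<open>V \<in> N x\<close> mult(1)[OF that] \<phi>_nonneg[OF that]
      by (intro member_le_sum) auto
    finally show ?thesis .
  qed
  define f where "f x V = (if V \<in> \<V> then \<phi> V x / S x else 0)" for x V
  have f_outside: "f x V = 0" if "x \<in> X" "V \<notin> N x" for x V
    using that \<phi>_outside by (auto simp: f_def N_def)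
  have f_sum: "(\<Sum>V\<in>N x. f x V) = 1" if "x \<in> X" for x
  proof -
    have "(\<Sum>V\<in>N x. f x V) = (\<Sum>V\<in>N x. \<phi> V x / S x)"
      by (intro sum.cong) (auto simp: f_def N_def)
    also have "\<dots> = S x / S x" unfolding S_def[of x] by (rule sum_divide_distrib[symmetric])
    finally show ?thesis using S_ge[OF that] \<open>0 < R\<close> by simp
  qed
  have supp: "supp_fn (f x) \<subseteq> N x" if "x \<in> X" for x
    using f_outside[OF that] by (auto simp: supp_fn_def)
  have f_std: "f x \<in> std_simplex" if "x \<in> X" for x
  proof -
    have "sum (f x) (supp_fn (f x)) = (\<Sum>V\<in>N x. f x V)"
      using supp[OF that] mult(1)[OF that] by (intro sum.mono_neutral_left) (auto simp: supp_fn_def)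
    then show ?thesis
      using f_sum[OF that] finite_subset[OF supp mult(1)] that \<phi>_nonneg[OF that] S_ge[OF that] \<open>0 < R\<close>
      by (auto simp: std_simplex_def f_def intro!: divide_nonneg_nonneg)
  qed
  have N_ne: "N x \<noteq> {}" if "x \<in> X" for x using f_sum[OF that] by auto
  have f_lip: "l2_dist (f x) (f y) \<le> lam * d x y" if x: "x \<in> X" and y: "y \<in> X" for x y
  proof -
    let ?N = "N x \<union> N y"
    have fin: "finite ?N" using mult(1) x y by simp
    have cardN: "real (card ?N) \<le> M"
      using card_Un_le[of "N x" "N y"] mult(2)[OF x] mult(2)[OF y] by (simp add: M_def)
    have d0: "0 \<le> d x y" using nonneg x y by simp
    have S_N: "S w = (\<Sum>V\<in>?N. \<phi> V w)" if "w = x \<or> w = y" for w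
      unfolding S_def using that x y \<phi>_outside fin by (intro sum.mono_neutral_left) (auto simp: N_def)
    have S_lip: "\<bar>S x - S y\<bar> \<le> M * d x y"
    proof -
      have "\<bar>S x - S y\<bar> \<le> (\<Sum>V\<in>?N. \<bar>\<phi> V x - \<phi> V y\<bar>)"
        by (simp add: S_N sum_subtractf[symmetric] sum_abs)
      also have "\<dots> \<le> (\<Sum>V\<in>?N. d x y)" by (intro sum_mono \<phi>_lip x y)
      also have "\<dots> \<le> M * d x y" using cardN d0 by (simp add: mult_right_mono)
      finally show ?thesis .
    qed
    have Spos: "0 < S x" "0 < S y" using S_ge[OF x] S_ge[OF y] \<open>0 < R\<close> by auto
    have pt: "\<bar>f x V - f y V\<bar> \<le> (M + 1) * d x y / R" if "V \<in> ?N" for V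
    proof -
      have "V \<in> \<V>" using that by (auto simp: N_def)
      have \<phi>S: "\<phi> V y \<le> S y"
        unfolding S_N[of y, simplified] using that fin \<phi>_nonneg[OF y] by (intro member_le_sum) auto
      \<comment> \<open>Numerator and denominator vary separately: the first term is controlled by
        \<phi>, the second by the sum \<open>S\<close>, with the quotient
        \<open>\<phi> V y / S y\<close> at most 1.\<close>
      have "f x V - f y V = (\<phi> V x - \<phi> V y) / S x + (\<phi> V y / S y) * ((S y - S x) / S x)"
        using Spos \<open>V \<in> \<V>\<close> by (simp add: f_def field_simps)
      also have "\<bar>\<dots>\<bar> \<le> \<bar>\<phi> V x - \<phi> V y\<bar> / S x + (\<phi> V y / S y) * (\<bar>S y - S x\<bar> / S x)"
        using Spos \<phi>_nonneg[OF y, of V] by (intro order_trans[OF abs_triangle_ineq]) (simp add: abs_mult)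
      also have "\<dots> \<le> d x y / S x + 1 * (M * d x y / S x)"
        using Spos \<phi>_nonneg[OF y, of V] \<phi>_lip[OF x y] S_lip \<phi>S
        by (intro add_mono mult_mono divide_right_mono) (auto simp: abs_minus_commute)
      also have "\<dots> = (M + 1) * d x y / S x"
        by (simp add: add_divide_distrib distrib_right)
      also have "\<dots> \<le> (M + 1) * d x y / R"
        using S_ge[OF x] \<open>0 < R\<close> \<open>0 < M\<close> d0 by (intro divide_left_mono) auto
      finally show ?thesis .
    qed
    have "l2_dist (f x) (f y) = L2_set (\<lambda>V. f x V - f y V) (supp_fn (f x) \<union> supp_fn (f y))"
      by (simp add: l2_dist_def L2_set_def)
    also have "\<dots> \<le> (\<Sum>V\<in>supp_fn (f x) \<union> supp_fn (f y). \<bar>f x V - f y V\<bar>)"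
      by (rule L2_set_le_sum_abs)
    also have "\<dots> \<le> (\<Sum>V\<in>?N. \<bar>f x V - f y V\<bar>)"
      using supp x y fin by (intro sum_mono2) auto
    also have "\<dots> \<le> (\<Sum>V\<in>?N. (M + 1) * d x y / R)" by (intro sum_mono pt)
    also have "\<dots> \<le> M * ((M + 1) * d x y / R)"
      using cardN d0 \<open>0 < M\<close> \<open>0 < R\<close> by (simp add: mult_right_mono divide_right_mono)
    also have "\<dots> = lam * d x y"
    proof -
      have "M + 1 \<noteq> 0" using \<open>0 < M\<close> by simp
      then show ?thesis using \<open>0 < M\<close> \<open>0 < lam\<close> by (simp add: R_def)
    qed
    finally show ?thesis .
  qed
  \<comment> \<open>This is the nerve of the cover, a simplex being a nonempty set of members with a
    common point of \<open>X\<close>.\<close>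
  define K where "K = {\<sigma>. \<sigma> \<noteq> {} \<and> (\<exists>x\<in>X. \<sigma> \<subseteq> N x)}"
  have "simplicial_complex K"
    unfolding simplicial_complex_def
  proof (intro conjI ballI allI impI)
    fix \<sigma> assume "\<sigma> \<in> K"
    then show "finite \<sigma>" "\<sigma> \<noteq> {}" using finite_subset mult(1) unfolding K_def by blast+
    fix \<tau> assume "\<tau> \<subseteq> \<sigma> \<and> \<tau> \<noteq> {}"
    then show "\<tau> \<in> K" using \<open>\<sigma> \<in> K\<close> unfolding K_def by blast
  qed
  moreover have "\<forall>\<sigma>\<in>K. card \<sigma> \<le> n + 1"
  proof
    fix \<sigma> assume "\<sigma> \<in> K"
    then obtain x where "x \<in> X" "\<sigma> \<subseteq> N x" by (auto simp: K_def)
    then show "card \<sigma> \<le> n + 1" using card_mono[OF mult(1)] mult(2) order_trans by blast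
  qed
  moreover have "f x \<in> polyhedron K" if "x \<in> X" for x
  proof -
    have "N x \<in> K" using that N_ne by (auto simp: K_def)
    moreover have "f x \<in> geom_simplex (N x)" using that f_std supp by (simp add: geom_simplex_def)
    ultimately show ?thesis by (auto simp: polyhedron_def)
  qed
  moreover have "\<exists>D'. \<forall>\<sigma>\<in>K. \<forall>x\<in>X. \<forall>y\<in>X.
      f x \<in> geom_simplex \<sigma> \<and> f y \<in> geom_simplex \<sigma> \<longrightarrow> d x y \<le> D'"
  proof (intro exI ballI impI, elim conjE)
    fix \<sigma> x y
    assume \<sigma>: "\<sigma> \<in> K" and x: "x \<in> X" "f x \<in> geom_simplex \<sigma>" and y: "y \<in> X" "f y \<in> geom_simplex \<sigma>"
    obtain p where p: "p \<in> X" "\<sigma> \<subseteq> N p" using \<sigma> by (auto simp: K_def)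
    \<comment> \<open>All vertices of the simplex contain \<open>p\<close>. A point mapped into the
      simplex lies in at least one of these vertices, so it shares a member with
      \<open>p\<close>.\<close>
    have near: "d w p \<le> D" if w: "w \<in> X" "f w \<in> geom_simplex \<sigma>" for w
    proof -
      have "supp_fn (f w) \<noteq> {}" using f_std[OF w(1)] by (auto simp: std_simplex_def)
      then obtain V where "V \<in> supp_fn (f w)" by blast
      then have "V \<in> N w" "V \<in> N p" using supp[OF w(1)] w(2) p(2) by (auto simp: geom_simplex_def)
      then show ?thesis using bdd w(1) p(1) by (auto simp: N_def)
    qed
    show "d x y \<le> D + D" using near[OF x] near[OF y] tri[OF x(1) p(1) y(1)] sym[OF y(1) p(1)] by linarith
  qed
  ultimately show "\<exists>(K :: 'b set set set) f.
        simplicial_complex K \<and> (\<forall>\<sigma>\<in>K. card \<sigma> \<le> n + 1) \<and>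
        (\<forall>x\<in>X. f x \<in> polyhedron K) \<and>
        (\<forall>x\<in>X. \<forall>y\<in>X. l2_dist (f x) (f y) \<le> lam * d x y) \<and>
        (\<exists>D. \<forall>\<sigma>\<in>K. \<forall>x\<in>X. \<forall>y\<in>X.
              f x \<in> geom_simplex \<sigma> \<and> f y \<in> geom_simplex \<sigma> \<longrightarrow> d x y \<le> D)"
    using f_lip by (intro exI[of _ K] exI[of _ f]) simp
qed

section \<open>The metric of the hyperbolic cone\<close>

lemma hyp_side_arg:
  "cosh a * cosh b - sinh a * sinh b * cos g
     = cosh (a - b) + sinh a * sinh b * (1 - cos g)" for a b g :: real
  by (simp add: cosh_diff algebra_simps)

text \<open>The law of cosines splits into a radial term and a nonnegative angular term. This keeps
  the argument of \<open>arcosh\<close> at least 1 and bounds the side below by the difference of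
  the heights.\<close>

lemma hyp_side_arg_ge:
  fixes a b g :: real
  assumes "0 \<le> a" "0 \<le> b"
  shows "cosh (a - b) \<le> cosh a * cosh b - sinh a * sinh b * cos g"
  unfolding hyp_side_arg using assms by simp

lemma cosh_hyp_side:
  assumes "0 \<le> a" "0 \<le> b"
  shows "cosh (hyp_side a b g) = cosh a * cosh b - sinh a * sinh b * cos g"
  unfolding hyp_side_def
  using hyp_side_arg_ge[OF assms, of g] cosh_real_ge_1[of "a - b"] by (intro cosh_arcosh_real) linarith

lemma hyp_side_nonneg:
  assumes "0 \<le> a" "0 \<le> b"
  shows "0 \<le> hyp_side a b g"
  unfolding hyp_side_def
  using hyp_side_arg_ge[OF assms, of g] cosh_real_ge_1[of "a - b"] by (intro arcosh_nonneg_real) linarith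

lemma hyp_side_commute: "hyp_side a b g = hyp_side b a g"
  by (simp add: hyp_side_def mult.commute)

lemma hyp_side_zero_left: "0 \<le> b \<Longrightarrow> hyp_side 0 b g = b"
  by (simp add: hyp_side_def arcosh_cosh_real)

lemma hyp_side_zero_right: "0 \<le> a \<Longrightarrow> hyp_side a 0 g = a"
  by (simp add: hyp_side_def arcosh_cosh_real)

lemma hyp_side_self: "hyp_side a a 0 = 0"
  using cosh_diff[of a a] by (simp add: hyp_side_def)

lemma abs_diff_le_hyp_side:
  assumes "0 \<le> a" "0 \<le> b"
  shows "\<bar>a - b\<bar> \<le> hyp_side a b g"
proof -
  have "cosh \<bar>a - b\<bar> \<le> cosh (hyp_side a b g)"
    using hyp_side_arg_ge[OF assms] by (simp add: cosh_hyp_side assms)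
  then show ?thesis
    using cosh_real_nonneg_le_iff[of "\<bar>a - b\<bar>" "hyp_side a b g"] hyp_side_nonneg[OF assms] by simp
qed

lemma hyp_side_mono:
  assumes "0 \<le> a" "0 \<le> b" "0 \<le> g" "g \<le> g'" "g' \<le> pi"
  shows "hyp_side a b g \<le> hyp_side a b g'"
proof -
  have "cos g' \<le> cos g" using assms by (intro cos_monotone_0_pi_le) auto
  then have "cosh (hyp_side a b g) \<le> cosh (hyp_side a b g')"
    using assms by (simp add: cosh_hyp_side mult_left_mono)
  then show ?thesis
    using hyp_side_nonneg assms by (simp add: cosh_real_nonneg_le_iff)
qed

lemma hyp_side_pi: "0 \<le> a \<Longrightarrow> 0 \<le> b \<Longrightarrow> hyp_side a b pi = a + b"
  by (simp add: hyp_side_def cosh_add[symmetric] arcosh_cosh_real)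

text \<open>The law of cosines in half-argument form. Radial and angular contributions are now a sum
  of squares, which gives bounds on the cone distance in both directions.\<close>

lemma sinh_half_hyp_side:
  assumes "0 \<le> a" "0 \<le> b"
  shows "(sinh (hyp_side a b g / 2))\<^sup>2 = (sinh ((a - b) / 2))\<^sup>2 + sinh a * sinh b * (sin (g / 2))\<^sup>2"
proof -
  have half: "cosh x = 1 + 2 * (sinh (x / 2))\<^sup>2" for x :: real
    using cosh_double[of "x / 2"] by (simp add: cosh_square_eq)
  have "1 - cos g = 2 * (sin (g / 2))\<^sup>2"
    using cos_double_sin[of "g / 2"] by simp
  then have "cosh (hyp_side a b g) = cosh (a - b) + 2 * (sinh a * sinh b * (sin (g / 2))\<^sup>2)"
    by (simp add: cosh_hyp_side assms hyp_side_arg)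
  then show ?thesis unfolding half[of "hyp_side a b g"] half[of "a - b"] by simp
qed

text \<open>Seen from the common vertex of the first two triangles, the opposite vertices lie in the
directions \<open>(x1, x2)\<close> and \<open>(y1, y2)\<close>; the inequality is Cauchy-Schwarz for these vectors.\<close>
lemma hyp_side_triangle_add:
  assumes "0 \<le> a" "0 \<le> b" "0 \<le> c"
  shows "hyp_side a c (\<alpha> + \<beta>) \<le> hyp_side a b \<alpha> + hyp_side b c \<beta>"
proof -
  define x y z where "x = hyp_side a b \<alpha>" and "y = hyp_side b c \<beta>" and "z = hyp_side a c (\<alpha> + \<beta>)"
  have nonneg: "0 \<le> x" "0 \<le> y" "0 \<le> z"
    using assms by (auto simp: x_def y_def z_def hyp_side_nonneg)
  define ca sa cb sb cc sc where
    "ca = cosh a" and "sa = sinh a" and "cb = cosh b" and "sb = sinh b" and "cc = cosh c" and "sc = sinh c"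
  define p q u v where "p = cos \<alpha>" and "q = sin \<alpha>" and "u = cos \<beta>" and "v = sin \<beta>"
  note abbr = ca_def sa_def cb_def sb_def cc_def sc_def p_def q_def u_def v_def
  have X: "cosh x = ca * cb - sa * sb * p" and Y: "cosh y = cb * cc - sb * sc * u"
    and Z: "cosh z = ca * cc - sa * sc * (p * u - q * v)"
    using assms by (simp_all add: x_def y_def z_def abbr cosh_hyp_side cos_add)
  have sq: "ca\<^sup>2 = 1 + sa\<^sup>2" "cb\<^sup>2 = 1 + sb\<^sup>2" "cc\<^sup>2 = 1 + sc\<^sup>2" "p\<^sup>2 = 1 - q\<^sup>2" "u\<^sup>2 = 1 - v\<^sup>2"
    by (simp_all add: abbr cosh_square_eq cos_squared_eq)
  \<comment> \<open>Components along and across the side of length \<open>b\<close> of vectors of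
    lengths \<open>sinh x\<close> and \<open>sinh y\<close>, found from the cosine and sine laws.
    The sign of \<open>y2\<close> places the two triangles on opposite sides of that side.\<close>
  define x1 x2 y1 y2 where "x1 = ca * sb - sa * cb * p" and "x2 = sa * q"
    and "y1 = cc * sb - sc * cb * u" and "y2 = - sc * v"
  have "(cosh x)\<^sup>2 = 1 + (x1\<^sup>2 + x2\<^sup>2)"
  proof -
    have "(cosh x)\<^sup>2 - x1\<^sup>2 = (cb\<^sup>2 - sb\<^sup>2) * (ca\<^sup>2 - sa\<^sup>2 * p\<^sup>2)"
      unfolding X x1_def by (simp add: power2_eq_square algebra_simps)
    then show ?thesis by (simp add: sq x2_def power_mult_distrib algebra_simps)
  qed
  then have sinh_x: "(sinh x)\<^sup>2 = x1\<^sup>2 + x2\<^sup>2" by (simp add: cosh_square_eq)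
  have "(cosh y)\<^sup>2 = 1 + (y1\<^sup>2 + y2\<^sup>2)"
  proof -
    have "(cosh y)\<^sup>2 - y1\<^sup>2 = (cb\<^sup>2 - sb\<^sup>2) * (cc\<^sup>2 - sc\<^sup>2 * u\<^sup>2)"
      unfolding Y y1_def by (simp add: power2_eq_square algebra_simps)
    then show ?thesis by (simp add: sq y2_def power_mult_distrib algebra_simps)
  qed
  then have sinh_y: "(sinh y)\<^sup>2 = y1\<^sup>2 + y2\<^sup>2" by (simp add: cosh_square_eq)
  \<comment> \<open>The law of cosines for the sides \<open>x\<close>, \<open>y\<close>,
    \<open>z\<close> at the middle point, where the inner product encodes the angle.\<close>
  have inner: "cosh z - cosh x * cosh y = - (x1 * y1 + x2 * y2)"
  proof -
    have "cosh x * cosh y - (x1 * y1 + x2 * y2)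
        = (cb\<^sup>2 - sb\<^sup>2) * (ca * cc - sa * sc * (p * u)) + sa * sc * (q * v)"
      unfolding X Y x1_def x2_def y1_def y2_def by (simp add: power2_eq_square algebra_simps)
    then show ?thesis by (simp add: sq Z algebra_simps)
  qed
  have "(x1 * y1 + x2 * y2)\<^sup>2 + (x1 * y2 - x2 * y1)\<^sup>2 = (x1\<^sup>2 + x2\<^sup>2) * (y1\<^sup>2 + y2\<^sup>2)"
    by (simp add: power2_eq_square algebra_simps)
  then have "(cosh z - cosh x * cosh y)\<^sup>2 \<le> (sinh x)\<^sup>2 * (sinh y)\<^sup>2"
    unfolding inner sinh_x sinh_y power2_minus using zero_le_power2[of "x1 * y2 - x2 * y1"] by linarith
  then have "cosh z - cosh x * cosh y \<le> sinh x * sinh y"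
    unfolding power_mult_distrib[symmetric]
    by (rule power2_le_imp_le) (use nonneg in simp)
  then have "cosh z \<le> cosh (x + y)" by (simp add: cosh_add)
  then show ?thesis
    using nonneg by (simp add: cosh_real_nonneg_le_iff x_def y_def z_def)
qed

text \<open>The side is monotone in the angle only up to \<open>pi\<close>. Shrinking \<beta> to at
  most \<open>pi - \<alpha>\<close> keeps the sum of the angles in that range and still at least
  \<gamma>, so the additive case applies.\<close>

lemma hyp_side_triangle:
  assumes "0 \<le> a" "0 \<le> b" "0 \<le> c"
    and "0 \<le> \<alpha>" "\<alpha> \<le> pi" "0 \<le> \<beta>" "\<beta> \<le> pi" "0 \<le> \<gamma>" "\<gamma> \<le> pi" "\<gamma> \<le> \<alpha> + \<beta>"
  shows "hyp_side a c \<gamma> \<le> hyp_side a b \<alpha> + hyp_side b c \<beta>"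
proof -
  define \<beta>' where "\<beta>' = min \<beta> (pi - \<alpha>)"
  have "hyp_side a c \<gamma> \<le> hyp_side a c (\<alpha> + \<beta>')"
    using assms by (intro hyp_side_mono) (auto simp: \<beta>'_def)
  also have "\<dots> \<le> hyp_side a b \<alpha> + hyp_side b c \<beta>'"
    using assms by (intro hyp_side_triangle_add)
  also have "hyp_side b c \<beta>' \<le> hyp_side b c \<beta>"
    using assms by (intro hyp_side_mono) (auto simp: \<beta>'_def)
  finally show ?thesis by simp
qed

section \<open>Elementary bounds for sine and hyperbolic sine\<close>

lemma sin_ge_third:
  fixes x :: real
  assumes "0 \<le> x" "x \<le> pi / 2"
  shows "x \<le> 3 * sin x"
proof -
  have "\<bar>sin x - (\<Sum>k<3. sin_coeff k * x ^ k)\<bar> \<le> inverse (fact 3) * \<bar>x\<bar> ^ 3"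
    by (rule Maclaurin_sin_bound)
  then have "\<bar>sin x - x\<bar> \<le> x ^ 3 / 6"
    using assms by (simp add: numeral_3_eq_3 sin_coeff_def fact_numeral field_simps)
  moreover have "x ^ 3 \<le> 4 * x"
  proof -
    have "x * x \<le> 2 * 2" using assms pi_less_4 by (intro mult_mono) auto
    then have "x * x * x \<le> 4 * x" using assms by (intro mult_right_mono) auto
    then show ?thesis by (simp add: power3_eq_cube)
  qed
  ultimately show ?thesis by linarith
qed

lemma sinh_ge_quarter_exp:
  fixes s :: real
  assumes "1 \<le> s"
  shows "exp s / 4 \<le> sinh s"
proof -
  have "2 \<le> exp s" using exp_ge_add_one_self[of s] assms by linarith
  then have "2 * exp (- s) \<le> exp s" using assms by (intro order_trans[of "2 * exp (- s)" 2 "exp s"]) auto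
  then show ?thesis by (simp add: sinh_field_def)
qed

section \<open>The cone in polar coordinates\<close>

definition cone_height :: "('a \<times> real) option \<Rightarrow> real" where
  "cone_height x = (case x of None \<Rightarrow> 0 | Some (z, t) \<Rightarrow> t)"

text \<open>The vertex of the cone gets an arbitrary base point, since the angle does not affect a
triangle with a side of length 0.\<close>
definition cone_base :: "'a set \<Rightarrow> ('a \<times> real) option \<Rightarrow> 'a" where
  "cone_base Z x = (case x of None \<Rightarrow> (SOME z. z \<in> Z) | Some (z, t) \<Rightarrow> z)"

lemma cone_height_nonneg: "x \<in> cone_carrier Z \<Longrightarrow> 0 \<le> cone_height x"
  by (auto simp: cone_carrier_def cone_height_def)

lemma cone_base_mem: "Z \<noteq> {} \<Longrightarrow> x \<in> cone_carrier Z \<Longrightarrow> cone_base Z x \<in> Z"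
  by (auto simp: cone_carrier_def cone_base_def some_in_eq)

lemma cone_dist_eq:
  assumes "x \<in> cone_carrier Z" "y \<in> cone_carrier Z"
  shows "cone_dist Z x y = hyp_side (cone_height x) (cone_height y)
           (cone_mu Z * dist (cone_base Z x) (cone_base Z y))"
  using assms
  by (auto simp: cone_carrier_def cone_dist_def cone_height_def cone_base_def hyp_side_zero_left
      hyp_side_zero_right)

context
  fixes Z :: "'a::metric_space set"
  assumes bounded: "bounded Z" and diam: "0 < diameter Z"
begin

lemma cone_nonempty: "Z \<noteq> {}"
  using diam by auto

lemma cone_mu_pos: "0 < cone_mu Z"
  using diam by (simp add: cone_mu_def)

lemma cone_angle:
  assumes "z \<in> Z" "w \<in> Z"
  shows "0 \<le> cone_mu Z * dist z w" "cone_mu Z * dist z w \<le> pi"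
proof -
  have "dist z w \<le> diameter Z" using diameter_bounded_bound[OF bounded assms] .
  then show "cone_mu Z * dist z w \<le> pi" using diam by (simp add: cone_mu_def field_simps)
qed (use diam in \<open>simp add: cone_mu_def\<close>)

lemma cone_dist_nonneg: "x \<in> cone_carrier Z \<Longrightarrow> y \<in> cone_carrier Z \<Longrightarrow> 0 \<le> cone_dist Z x y"
  by (simp add: cone_dist_eq hyp_side_nonneg cone_height_nonneg)

lemma cone_dist_commute:
  "x \<in> cone_carrier Z \<Longrightarrow> y \<in> cone_carrier Z \<Longrightarrow> cone_dist Z x y = cone_dist Z y x"
  by (simp add: cone_dist_eq dist_commute hyp_side_commute[of "cone_height x"])

lemma cone_dist_self: "x \<in> cone_carrier Z \<Longrightarrow> cone_dist Z x x = 0"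
  by (simp add: cone_dist_eq hyp_side_self)

lemma cone_dist_triangle:
  assumes "x \<in> cone_carrier Z" "y \<in> cone_carrier Z" "w \<in> cone_carrier Z"
  shows "cone_dist Z x w \<le> cone_dist Z x y + cone_dist Z y w"
proof -
  have "cone_mu Z * dist (cone_base Z x) (cone_base Z w)
      \<le> cone_mu Z * (dist (cone_base Z x) (cone_base Z y) + dist (cone_base Z y) (cone_base Z w))"
    using cone_mu_pos by (intro mult_left_mono dist_triangle) auto
  then show ?thesis
    using assms cone_nonempty
    by (simp add: cone_dist_eq distrib_left hyp_side_triangle cone_height_nonneg cone_base_mem
        cone_angle)
qed

lemma cone_height_diff_le:
  assumes "x \<in> cone_carrier Z" "y \<in> cone_carrier Z"
  shows "\<bar>cone_height x - cone_height y\<bar> \<le> cone_dist Z x y"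
  using assms by (simp add: cone_dist_eq abs_diff_le_hyp_side cone_height_nonneg)

lemma cone_dist_le_height_add:
  assumes "x \<in> cone_carrier Z" "y \<in> cone_carrier Z"
  shows "cone_dist Z x y \<le> cone_height x + cone_height y"
  using assms hyp_side_mono[of "cone_height x" "cone_height y" _ pi]
  by (simp add: cone_dist_eq cone_height_nonneg cone_angle cone_base_mem cone_nonempty
      hyp_side_pi[symmetric])

text \<open>The angular term of the half-argument formula is at most the square of
  \<open>sinh (r / 2)\<close>, while both heights contribute at least \<open>sinh s\<close>. The
  constant 24 is 4 from \<open>exp s / 4 \<le> sinh s\<close> times 6 from bounding the angle by
  \<open>6 * sin (g / 2)\<close>.\<close>

lemma dist_cone_base_less:
  assumes x: "x \<in> cone_carrier Z" and y: "y \<in> cone_carrier Z"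
    and s: "1 \<le> s" "s \<le> cone_height x" "s \<le> cone_height y" and r: "cone_dist Z x y < r"
  shows "dist (cone_base Z x) (cone_base Z y) < 24 * sinh (r / 2) / cone_mu Z * exp (- s)"
proof -
  define g where "g = cone_mu Z * dist (cone_base Z x) (cone_base Z y)"
  have g: "0 \<le> g" "g \<le> pi"
    unfolding g_def using x y by (simp_all add: cone_angle cone_base_mem cone_nonempty)
  have g3: "g / 2 \<le> 3 * sin (g / 2)" using g by (intro sin_ge_third) auto
  have "(sinh s * sin (g / 2))\<^sup>2 \<le> sinh (cone_height x) * sinh (cone_height y) * (sin (g / 2))\<^sup>2"
    unfolding power_mult_distrib power2_eq_square[of "sinh s"]
    using s by (intro mult_right_mono mult_mono) auto
  also have "\<dots> \<le> (sinh (cone_dist Z x y / 2))\<^sup>2"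
    using x y by (simp add: cone_dist_eq g_def[symmetric] sinh_half_hyp_side cone_height_nonneg)
  finally have "sinh s * sin (g / 2) \<le> sinh (cone_dist Z x y / 2)"
    by (rule power2_le_imp_le) (use cone_dist_nonneg[OF x y] in simp)
  also have "\<dots> < sinh (r / 2)" using r by simp
  finally have "sinh s * sin (g / 2) < sinh (r / 2)" .
  moreover have "exp s * sin (g / 2) \<le> 4 * (sinh s * sin (g / 2))"
  proof -
    have "exp s / 4 * sin (g / 2) \<le> sinh s * sin (g / 2)"
      using sinh_ge_quarter_exp[OF s(1)] g by (intro mult_right_mono sin_ge_zero) auto
    then show ?thesis by simp
  qed
  moreover have "exp s * g \<le> 6 * (exp s * sin (g / 2))"
  proof -
    have "exp s * g \<le> exp s * (6 * sin (g / 2))" using g3 by (intro mult_left_mono) auto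
    then show ?thesis by simp
  qed
  ultimately have "exp s * g < 24 * sinh (r / 2)" by argo
  then show ?thesis
    using cone_mu_pos by (simp add: g_def exp_minus field_simps)
qed

text \<open>The reverse comparison. The growth \<open>exp H\<close> of each hyperbolic sine cancels
  the factor \<open>exp (- H)\<close> in the angle, so the bound depends on \<open>T\<close> and
  \<open>C\<close> alone and is the same at all heights.\<close>

lemma cone_dist_le_if_base_close:
  assumes x: "x \<in> cone_carrier Z" and y: "y \<in> cone_carrier Z"
    and h: "\<bar>cone_height x - cone_height y\<bar> \<le> 2 * T" "cone_height x \<le> H" "cone_height y \<le> H"
    and dist: "cone_mu Z * dist (cone_base Z x) (cone_base Z y) \<le> C * exp (- H)"
  shows "cone_dist Z x y \<le> 2 * arsinh (sinh T + C)"
proof -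
  define g where "g = cone_mu Z * dist (cone_base Z x) (cone_base Z y)"
  have g: "0 \<le> g" "g \<le> pi"
    unfolding g_def using x y by (simp_all add: cone_angle cone_base_mem cone_nonempty)
  have "0 \<le> C * exp (- H)" using g(1) dist by (simp add: g_def)
  then have "0 \<le> C" by (simp add: zero_le_mult_iff)
  have "0 \<le> T" using h(1) by linarith
  have sinh_le: "sinh t \<le> exp H" if "t \<le> H" for t
  proof -
    have "sinh t \<le> exp t" using order_trans[of "- exp (- t)" 0 "exp t"] by (simp add: sinh_field_def)
    also have "\<dots> \<le> exp H" using that by simp
    finally show ?thesis .
  qed
  have "sin (g / 2) \<le> g / 2" using g by (intro sin_x_le_x) auto
  then have "sin (g / 2) \<le> C * exp (- H)" using dist g by (simp add: g_def[symmetric])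
  moreover have "0 \<le> sin (g / 2)" using g by (intro sin_ge_zero) auto
  ultimately have "sinh (cone_height x) * sinh (cone_height y) * (sin (g / 2))\<^sup>2
      \<le> exp H * exp H * (C * exp (- H))\<^sup>2"
    using sinh_le h cone_height_nonneg x y by (intro mult_mono power_mono) auto
  also have "\<dots> = C\<^sup>2" by (simp add: power2_eq_square exp_minus field_simps)
  finally have 1: "sinh (cone_height x) * sinh (cone_height y) * (sin (g / 2))\<^sup>2 \<le> C\<^sup>2" .
  have "\<bar>sinh ((cone_height x - cone_height y) / 2)\<bar> = sinh \<bar>(cone_height x - cone_height y) / 2\<bar>"
    by (rule sinh_real_abs[symmetric])
  also have "\<dots> \<le> sinh T" unfolding sinh_real_le_iff using h(1) by simp
  finally have "\<bar>sinh ((cone_height x - cone_height y) / 2)\<bar>\<^sup>2 \<le> (sinh T)\<^sup>2"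
    by (rule power_mono) simp
  then have 2: "(sinh ((cone_height x - cone_height y) / 2))\<^sup>2 \<le> (sinh T)\<^sup>2"
    unfolding power2_abs .
  have "(sinh (cone_dist Z x y / 2))\<^sup>2 \<le> (sinh T)\<^sup>2 + C\<^sup>2"
    using 1 2 x y
    by (simp add: cone_dist_eq g_def[symmetric] sinh_half_hyp_side cone_height_nonneg)
  also have "\<dots> \<le> (sinh T + C)\<^sup>2" using \<open>0 \<le> T\<close> \<open>0 \<le> C\<close> by (simp add: power2_sum)
  finally have "sinh (cone_dist Z x y / 2) \<le> sinh T + C"
    by (rule power2_le_imp_le) (use \<open>0 \<le> T\<close> \<open>0 \<le> C\<close> in simp)
  then have "sinh (cone_dist Z x y / 2) \<le> sinh (arsinh (sinh T + C))" by simp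
  then have "cone_dist Z x y / 2 \<le> arsinh (sinh T + C)" unfolding sinh_real_le_iff .
  then show ?thesis by simp
qed

end

section \<open>Capacity dimension\<close>

lemma dist_le_ediam:
  assumes "x \<in> U" "y \<in> U"
  shows "ereal (dist x y) \<le> ediam U"
proof -
  have "ereal (dist (fst (x, y)) (snd (x, y))) \<le> (SUP p\<in>U \<times> U. ereal (dist (fst p) (snd p)))"
    using assms by (intro SUP_upper) simp
  then show ?thesis using assms by (auto simp: ediam_def)
qed

text \<open>Suprema of empty families are minus infinity in the extended reals. Every point lies in
  a member of the covering, so this value does not occur in the local mesh or the local Lebesgue
  number.\<close>

lemma cap_nonneg:
  assumes "open_covering Z \<U>" "0 \<le> mesh \<U>"
  shows "0 \<le> cap Z \<U>"
proof -
  have "0 \<le> leb_at Z \<U> z" if "z \<in> Z" for z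
  proof -
    have "z \<in> \<Union>\<U>" using assms(1) that by (simp add: open_covering_def)
    then obtain U where U: "U \<in> \<U>" "z \<in> U" by blast
    have "0 \<le> dist_compl Z z U" by (simp add: dist_compl_def infdist_nonneg)
    then have "0 \<le> (SUP U\<in>\<U>. dist_compl Z z U)" by (rule SUP_upper2[OF U(1)])
    moreover have "0 \<le> ediam U" using dist_le_ediam[OF U(2,2)] by (simp add: zero_ereal_def)
    then have "0 \<le> mesh_at \<U> z"
      unfolding mesh_at_def using U by (intro SUP_upper2[of U]) simp_all
    ultimately show ?thesis unfolding leb_at_def by (rule min.boundedI)
  qed
  then have "0 \<le> leb Z \<U>" unfolding leb_def by (intro INF_greatest)
  then show ?thesis using assms(2)
    by (simp add: cap_def zero_le_divide_ereal)
qed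

lemma c_tau_nonneg:
  assumes "0 < \<delta>" "0 < \<tau>"
  shows "0 \<le> c_tau Z m \<delta> \<tau>"
proof -
  define S where "S = {cap Z \<U> | \<U>. open_covering Z \<U> \<and> colored (m + 1) \<U> \<and>
                           ereal (\<delta> * \<tau>) \<le> mesh \<U> \<and> mesh \<U> \<le> ereal \<tau>}"
  have cap: "0 \<le> cap Z \<U>" if "open_covering Z \<U>" "ereal (\<delta> * \<tau>) \<le> mesh \<U>" for \<U>
  proof (rule cap_nonneg[OF that(1)])
    have "0 \<le> ereal (\<delta> * \<tau>)" using assms by simp
    then show "0 \<le> mesh \<U>" using that(2) by (rule order_trans)
  qed
  have "0 \<le> Sup S" if ne: "S \<noteq> {}"
  proof -
    obtain s where s: "s \<in> S" using ne by blast
    then have "0 \<le> s" unfolding S_def by (elim CollectE exE conjE) (simp add: cap)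
    with s show ?thesis by (rule Sup_upper2)
  qed
  moreover have "c_tau Z m \<delta> \<tau> = (if S = {} then 0 else Sup S)"
    unfolding c_tau_def Let_def S_def by (rule HOL.refl)
  ultimately show ?thesis by simp
qed

text \<open>Otherwise nonnegativity forces \<open>c_delta Z m\<close> to vanish at every positive
  argument, and then its limit at 0 is 0.\<close>

lemma c_delta_pos_if_c_cap_pos:
  assumes "0 < c_cap Z m"
  shows "\<exists>\<delta>>0. 0 < c_delta Z m \<delta>"
proof (rule ccontr)
  assume "\<not> ?thesis"
  then have nonpos: "c_delta Z m \<delta> \<le> 0" if "0 < \<delta>" for \<delta>
    using that by (meson not_less)
  have "c_delta Z m \<delta> = 0" if "0 < \<delta>" for \<delta>
  proof (rule antisym[OF nonpos[OF that]])
    have "eventually (\<lambda>\<tau>. 0 \<le> c_tau Z m \<delta> \<tau>) (at_right 0)"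
      using eventually_at_right_less[of "0::real"]
      by (rule eventually_mono) (rule c_tau_nonneg[OF that])
    then show "0 \<le> c_delta Z m \<delta>" unfolding c_delta_def by (rule Liminf_bounded)
  qed
  then have "eventually (\<lambda>\<delta>. c_delta Z m \<delta> = 0) (at_right 0)"
    by (rule eventually_mono[OF eventually_at_right_less[of "0::real"]])
  then have "(c_delta Z m \<longlongrightarrow> 0) (at_right 0)" by (rule tendsto_eventually)
  then have "c_cap Z m = 0" unfolding c_cap_def by (rule tendsto_Lim[OF trivial_limit_at_right_real])
  then show False using assms by simp
qed

text \<open>The real-valued data kept from a covering of positive capacity: a bound \<tau> on
  diameters, a Lebesgue number \<open>l\<close> expressed by inclusion of balls, and an explicit
  coloring with colors from 0 to \<open>m\<close>.\<close>

definition colored_cover :: "'a::metric_space set \<Rightarrow> nat \<Rightarrow> real \<Rightarrow> real \<Rightarrow> 'a set set \<Rightarrow> ('a set \<Rightarrow> nat) \<Rightarrow> bool"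
  where "colored_cover Z m \<tau> l \<U> col \<longleftrightarrow>
    (\<forall>U\<in>\<U>. U \<subseteq> Z \<and> col U \<le> m \<and> (\<forall>x\<in>U. \<forall>y\<in>U. dist x y \<le> \<tau>)) \<and>
    (\<forall>U\<in>\<U>. \<forall>V\<in>\<U>. col U = col V \<and> U \<inter> V \<noteq> {} \<longrightarrow> U = V) \<and>
    (\<forall>z\<in>Z. \<exists>U\<in>\<U>. \<forall>w\<in>Z. dist z w < l \<longrightarrow> w \<in> U)"

lemma colored_coverD:
  assumes "colored_cover Z m \<tau> l \<U> col"
  shows "U \<in> \<U> \<Longrightarrow> U \<subseteq> Z"
    and "U \<in> \<U> \<Longrightarrow> col U \<le> m"
    and "\<lbrakk>U \<in> \<U>; x \<in> U; y \<in> U\<rbrakk> \<Longrightarrow> dist x y \<le> \<tau>"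
    and "\<lbrakk>U \<in> \<U>; V \<in> \<U>; col U = col V; z \<in> U; z \<in> V\<rbrakk> \<Longrightarrow> U = V"
    and "z \<in> Z \<Longrightarrow> \<exists>U\<in>\<U>. \<forall>w\<in>Z. dist z w < l \<longrightarrow> w \<in> U"
proof -
  have *: "\<forall>U\<in>\<U>. U \<subseteq> Z \<and> col U \<le> m \<and> (\<forall>x\<in>U. \<forall>y\<in>U. dist x y \<le> \<tau>)"
    and disjoint: "\<forall>U\<in>\<U>. \<forall>V\<in>\<U>. col U = col V \<and> U \<inter> V \<noteq> {} \<longrightarrow> U = V"
    and lebesgue: "\<forall>z\<in>Z. \<exists>U\<in>\<U>. \<forall>w\<in>Z. dist z w < l \<longrightarrow> w \<in> U"
    using assms unfolding colored_cover_def by (rule conjunct1, rule conjunct2[THEN conjunct1], rule conjunct2[THEN conjunct2])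
  show "U \<in> \<U> \<Longrightarrow> U \<subseteq> Z" "U \<in> \<U> \<Longrightarrow> col U \<le> m"
    "\<lbrakk>U \<in> \<U>; x \<in> U; y \<in> U\<rbrakk> \<Longrightarrow> dist x y \<le> \<tau>"
    using * by blast+
  show "U = V" if "U \<in> \<U>" "V \<in> \<U>" "col U = col V" "z \<in> U" "z \<in> V"
    using disjoint[rule_format, OF that(1,2)] that(3-5) by blast
  show "z \<in> Z \<Longrightarrow> \<exists>U\<in>\<U>. \<forall>w\<in>Z. dist z w < l \<longrightarrow> w \<in> U"
    using lebesgue by blast
qed

lemma ediam_le_mesh: "U \<in> \<U> \<Longrightarrow> ediam U \<le> mesh \<U>"
  unfolding mesh_def by (rule SUP_upper)

lemma mem_if_dist_less_dist_compl:
  assumes "ereal l < dist_compl Z z U" "w \<in> Z" "dist z w < l"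
  shows "w \<in> U"
proof (rule ccontr)
  assume "w \<notin> U"
  then have "infdist z (Z - U) \<le> dist z w" using assms(2) by (intro infdist_le) auto
  moreover have "l < infdist z (Z - U)"
    using assms(1,2) \<open>w \<notin> U\<close> by (auto simp: dist_compl_def split: if_splits)
  ultimately show False using assms(3) by simp
qed

text \<open>The mesh lies between \<open>\<delta> * \<tau> > 0\<close> and \<tau>, so the
  conventional value 1 of \<open>cap\<close> does not arise. Capacity above \<open>e\<close>
  therefore means a Lebesgue number above \<open>e\<close> times the mesh, hence above
  \<open>e * \<delta> * \<tau>\<close>. Positive mesh also excludes bounded spaces of diameter
  0.\<close>

lemma colored_cover_if_cap_greater:
  assumes cover: "open_covering Z \<U>" "colored (m + 1) \<U>"
    and mesh: "ereal (\<delta> * \<tau>) \<le> mesh \<U>" "mesh \<U> \<le> ereal \<tau>" and pos: "0 < \<delta>" "0 < \<tau>" "0 < e"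
    and cap: "ereal e < cap Z \<U>"
  shows "\<exists>col. colored_cover Z m \<tau> (e * \<delta> * \<tau>) \<U> col" and "0 < diameter Z \<or> \<not> bounded Z"
proof -
  have "\<delta> * \<tau> > 0" using pos by simp
  obtain M where M: "mesh \<U> = ereal M" "\<delta> * \<tau> \<le> M"
    using mesh by (cases "mesh \<U>") auto
  then have "0 < M" using \<open>\<delta> * \<tau> > 0\<close> by simp
  have "ereal e < leb Z \<U> / ereal M"
    using cap M \<open>0 < M\<close> by (simp add: cap_def split: if_splits)
  then have leb: "ereal (e * M) < leb Z \<U>"
    using \<open>0 < M\<close> by (simp add: ereal_less_divide_pos mult.commute)
  have Leb: "\<exists>U\<in>\<U>. \<forall>w\<in>Z. dist z w < e * \<delta> * \<tau> \<longrightarrow> w \<in> U" if "z \<in> Z" for z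
  proof -
    have "leb Z \<U> \<le> leb_at Z \<U> z" unfolding leb_def using that by (rule INF_lower)
    then have "ereal (e * M) < (SUP U\<in>\<U>. dist_compl Z z U)"
      using leb by (auto simp: leb_at_def)
    then obtain U where U: "U \<in> \<U>" "ereal (e * M) < dist_compl Z z U"
      by (auto simp: less_SUP_iff)
    have "e * \<delta> * \<tau> \<le> e * M" using M(2) pos by simp
    then have "w \<in> U" if "w \<in> Z" "dist z w < e * \<delta> * \<tau>" for w
      using that mem_if_dist_less_dist_compl[OF U(2) that(1)] by linarith
    then show ?thesis using U(1) by blast
  qed
  obtain col where col: "\<forall>U\<in>\<U>. col U < m + 1"
      "\<forall>U\<in>\<U>. \<forall>V\<in>\<U>. U \<noteq> V \<and> col U = col V \<longrightarrow> U \<inter> V = {}"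
    using cover(2) unfolding colored_def by (elim exE conjE)
  have "dist x y \<le> \<tau>" if "U \<in> \<U>" "x \<in> U" "y \<in> U" for U x y
  proof -
    have "ereal (dist x y) \<le> ereal \<tau>"
      using dist_le_ediam[OF that(2,3)] ediam_le_mesh[OF that(1)] mesh(2) by (meson order_trans)
    then show ?thesis by simp
  qed
  moreover have sub: "U \<subseteq> Z" if "U \<in> \<U>" for U
    using cover(1) that unfolding open_covering_def by blast
  ultimately show "\<exists>col. colored_cover Z m \<tau> (e * \<delta> * \<tau>) \<U> col"
    unfolding colored_cover_def using col Leb
    by (intro exI[of _ col] conjI) (simp_all add: less_Suc_eq_le, blast)
  show "0 < diameter Z \<or> \<not> bounded Z"
  proof (rule ccontr)
    assume "\<not> ?thesis"
    then have "bounded Z" "diameter Z \<le> 0" by auto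
    have "dist x y \<le> 0" if "U \<in> \<U>" "x \<in> U" "y \<in> U" for U x y
    proof -
      have "x \<in> Z" "y \<in> Z" using sub that by auto
      from diameter_bounded_bound[OF \<open>bounded Z\<close> this] show ?thesis
        using \<open>diameter Z \<le> 0\<close> by linarith
    qed
    then have "ediam U \<le> 0" if "U \<in> \<U>" for U
      unfolding ediam_def using that by (simp add: SUP_le_iff)
    then have "mesh \<U> \<le> 0" unfolding mesh_def by (intro SUP_least)
    then show False using M \<open>0 < M\<close> by simp
  qed
qed

text \<open>A positive lower limit provides one ratio \<open>c = e * \<delta>\<close> of Lebesgue
  number to scale that is valid at all small scales. This uniformity permits a sequence of covers at
  geometrically decreasing scales.\<close>

lemma small_scale_covers:
  assumes "0 < c_cap Z m"
  obtains \<tau>0 c where "0 < \<tau>0" "0 < c"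
    "\<And>\<tau>. 0 < \<tau> \<Longrightarrow> \<tau> \<le> \<tau>0 \<Longrightarrow> \<exists>\<U> col. colored_cover Z m \<tau> (c * \<tau>) \<U> col"
    "bounded Z \<Longrightarrow> 0 < diameter Z"
proof -
  obtain \<delta> where \<delta>: "0 < \<delta>" "0 < c_delta Z m \<delta>"
    using c_delta_pos_if_c_cap_pos[OF assms] by blast
  obtain e where e: "0 < ereal e" "ereal e < c_delta Z m \<delta>"
    using ereal_dense2[OF \<delta>(2)] by auto
  have "eventually (\<lambda>\<tau>. ereal e < c_tau Z m \<delta> \<tau>) (at_right 0)"
    using e(2) unfolding c_delta_def by (rule less_LiminfD)
  then obtain b where b: "0 < b" "\<And>\<tau>. 0 < \<tau> \<Longrightarrow> \<tau> < b \<Longrightarrow> ereal e < c_tau Z m \<delta> \<tau>"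
    unfolding eventually_at_right_field by blast
  have ex: "\<exists>\<U>. (\<exists>col. colored_cover Z m \<tau> (e * \<delta> * \<tau>) \<U> col) \<and> (0 < diameter Z \<or> \<not> bounded Z)"
    if "0 < \<tau>" "\<tau> \<le> b / 2" for \<tau>
  proof -
    have "ereal e < c_tau Z m \<delta> \<tau>" using b that by simp
    then obtain \<U> where "open_covering Z \<U>" "colored (m + 1) \<U>"
        "ereal (\<delta> * \<tau>) \<le> mesh \<U>" "mesh \<U> \<le> ereal \<tau>" "ereal e < cap Z \<U>"
      using e(1) unfolding c_tau_def Let_def
      by (auto simp: less_Sup_iff split: if_splits)
    from colored_cover_if_cap_greater[OF this(1-4) \<delta>(1) that(1) _ this(5)] e(1)
    show ?thesis by auto
  qed
  show thesis
  \<comment> \<open>Halving \<open>b\<close> turns the open range of scales into one that includes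
    its upper end.\<close>
  proof (rule that[of "b / 2" "e * \<delta>"])
    show "0 < b / 2" "0 < e * \<delta>" using b(1) e(1) \<delta>(1) by auto
    show "\<exists>\<U> col. colored_cover Z m \<tau> (e * \<delta> * \<tau>) \<U> col" if "0 < \<tau>" "\<tau> \<le> b / 2" for \<tau>
      using ex[OF that] by blast
    show "0 < diameter Z" if "bounded Z" using ex[of "b / 2"] b(1) that by auto
  qed
qed

section \<open>Interpolating between covers of different scales\<close>

text \<open>Here \<open>b\<close> is the projection to the base and \<open>u\<close> a shifted
  height whose negative values form the core, covered through \<open>\<U> 0 = {Z}\<close>. The bound
  on \<open>T\<close> leaves room in each level for one window of width \<open>2 * r\<close> per
  color and one spare window.\<close>

locale layered_cover =
  fixes X :: "'x set" and b :: "'x \<Rightarrow> 'a" and u :: "'x \<Rightarrow> real"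
    and Z :: "'a set" and \<U> :: "nat \<Rightarrow> 'a set set" and col :: "nat \<Rightarrow> 'a set \<Rightarrow> nat"
    and \<rho> :: "nat \<Rightarrow> 'a set \<Rightarrow> 'a set" and m :: nat and r T :: real
  assumes r_pos: "0 < r" and T_ge: "2 * r * (real m + 2) \<le> T"
    and \<U>_0: "\<U> 0 = {Z}" and base_mem: "x \<in> X \<Longrightarrow> b x \<in> Z"
    and \<rho>_mem: "U \<in> \<U> (Suc k) \<Longrightarrow> \<rho> k U \<in> \<U> k"
    and subset_\<rho>: "U \<in> \<U> (Suc k) \<Longrightarrow> U \<subseteq> \<rho> k U"
    and col_le: "U \<in> \<U> k \<Longrightarrow> col k U \<le> m"
    and col_inj: "\<lbrakk>U \<in> \<U> k; V \<in> \<U> k; col k U = col k V; z \<in> U; z \<in> V\<rbrakk> \<Longrightarrow> U = V"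
begin

text \<open>Between the levels \<open>k * T\<close> and \<open>(k + 1) * T\<close> the members of \<open>\<U> (k + 1)\<close> of color
\<open>i\<close> are still merged into their images under \<open>\<rho> k\<close> below height \<open>2 * r * (i + 1)\<close>
and already occur on their own above height \<open>2 * r * i\<close>. So at any height at most one color is
counted twice.\<close>
definition layer_set :: "nat \<Rightarrow> 'a set \<Rightarrow> 'x set" where
  "layer_set k U =
     {x\<in>X. b x \<in> U \<and> u x < real k * T \<and> (k = 0 \<or> real k * T - T + 2 * r * real (col k U) \<le> u x)} \<union>
     {x\<in>X. real k * T \<le> u x \<and> (\<exists>U'\<in>\<U> (Suc k). \<rho> k U' = U \<and> b x \<in> U' \<and>
                u x < real k * T + 2 * r * (real (col (Suc k) U') + 1))}"

definition layer_sets :: "'x set set" where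
  "layer_sets = {layer_set k U | k U. U \<in> \<U> k}"

lemma T_pos: "0 < T"
proof -
  have "0 < 2 * r * (real m + 2)" using r_pos by (intro mult_pos_pos) auto
  then show ?thesis using T_ge by linarith
qed

lemma window_le: "U \<in> \<U> k \<Longrightarrow> 2 * r * (real (col k U) + 1) + 2 * r \<le> T"
proof -
  assume "U \<in> \<U> k"
  then have "2 * r * (real (col k U) + 2) \<le> 2 * r * (real m + 2)"
    using col_le r_pos by (intro mult_left_mono) auto
  then show ?thesis using T_ge by (simp add: algebra_simps)
qed

lemma level_unique:
  assumes "real j * T \<le> t" "t < real j * T + T" "real k * T \<le> t" "t < real k * T + T"
  shows "j = k"
proof -
  have "real j * T < (real k + 1) * T" "real k * T < (real j + 1) * T"
    using assms by (simp_all add: algebra_simps)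
  then have "real j < real k + 1" "real k < real j + 1"
    using T_pos by (simp_all only: mult_less_cancel_right_pos)
  then show ?thesis by linarith
qed

lemma obtain_level:
  assumes "0 \<le> t"
  obtains k where "real k * T \<le> t" "t < real k * T + T"
proof -
  have "0 \<le> t / T" using assms T_pos by simp
  then have "real (nat \<lfloor>t / T\<rfloor>) \<le> t / T" "t / T < real (nat \<lfloor>t / T\<rfloor>) + 1"
    by linarith+
  then have "real (nat \<lfloor>t / T\<rfloor>) * T \<le> t" "t < (real (nat \<lfloor>t / T\<rfloor>) + 1) * T"
    using T_pos by (simp_all only: pos_le_divide_eq pos_divide_less_eq)
  then show thesis by (intro that) (simp_all add: distrib_right)
qed

text \<open>Confines a layer set to two consecutive levels over one member of the base cover. This
  gives bounded members, and below height 0 it leaves only level 0.\<close>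

lemma layer_set_height:
  assumes "U \<in> \<U> k" "x \<in> layer_set k U"
  shows "b x \<in> U" "u x < real k * T + T" "k = 0 \<or> real k * T - T \<le> u x"
proof -
  have "(b x \<in> U \<and> u x < real k * T \<and> (k = 0 \<or> real k * T - T + 2 * r * real (col k U) \<le> u x)) \<or>
    (real k * T \<le> u x \<and> (\<exists>U'\<in>\<U> (Suc k). \<rho> k U' = U \<and> b x \<in> U' \<and>
                u x < real k * T + 2 * r * (real (col (Suc k) U') + 1)))"
    using assms(2) unfolding layer_set_def by blast
  then have "b x \<in> U \<and> u x < real k * T + T \<and> (k = 0 \<or> real k * T - T \<le> u x)"
  proof (elim disjE conjE bexE)
    fix U' assume U': "U' \<in> \<U> (Suc k)" "\<rho> k U' = U" "b x \<in> U'" "real k * T \<le> u x"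
      "u x < real k * T + 2 * r * (real (col (Suc k) U') + 1)"
    then show ?thesis using window_le[OF U'(1)] subset_\<rho>[OF U'(1)] r_pos T_pos by auto
  next
    assume *: "b x \<in> U" "u x < real k * T" "real k * T - T + 2 * r * real (col k U) \<le> u x"
    moreover have "0 \<le> 2 * r * real (col k U)" using r_pos by simp
    ultimately show ?thesis using T_pos by linarith
  qed (use T_pos in auto)
  then show "b x \<in> U" "u x < real k * T + T" "k = 0 \<or> real k * T - T \<le> u x" by auto
qed

text \<open>The members of \<open>\<U> (Suc k)\<close> over a point have distinct colors, so there
  are at most \<open>m + 1\<close>. Each accounts for its merged set or its own set, and for both
  only inside the window of its color; these windows are disjoint.\<close>

lemma layer_sets_multiplicity:
  assumes x: "x \<in> X"
  shows "finite {V\<in>layer_sets. x \<in> V} \<and> card {V\<in>layer_sets. x \<in> V} \<le> m + 2"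
proof (cases "u x < 0")
  case True
  have "V = layer_set 0 Z" if V: "V \<in> layer_sets" "x \<in> V" for V
  proof -
    obtain k U where kU: "V = layer_set k U" "U \<in> \<U> k" using V(1) by (auto simp: layer_sets_def)
    have "k = 0"
    proof (rule ccontr)
      assume "k \<noteq> 0"
      then have "1 * T \<le> real k * T" using T_pos by (intro mult_right_mono) auto
      then show False
        using layer_set_height(3)[of U k x] kU V(2) \<open>k \<noteq> 0\<close> True by simp
    qed
    then show ?thesis using kU \<U>_0 by simp
  qed
  then have sub: "{V\<in>layer_sets. x \<in> V} \<subseteq> {layer_set 0 Z}" by blast
  show ?thesis using finite_subset[OF sub] card_mono[OF _ sub] by simp
next
  case False
  then obtain k where k: "real k * T \<le> u x" "u x < real k * T + T"
    using obtain_level[of "u x"] by (metis not_less)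
  define w where "w = u x - real k * T"
  define S where "S = {U\<in>\<U> (Suc k). b x \<in> U}"
  let ?c = "col (Suc k)"
  have inj: "inj_on ?c S" using col_inj by (auto simp: inj_on_def S_def)
  have img: "?c ` S \<subseteq> {..m}" using col_le by (auto simp: S_def)
  have fin: "finite S" using inj img by (meson finite_atMost finite_imageD finite_subset)
  have cardS: "card S \<le> m + 1"
    using card_mono[OF _ img] card_image[OF inj] by simp
  \<comment> \<open>\<open>S1\<close> collects the members still merged into their image under
    \<rho> at relative height \<open>w\<close>, \<open>S2\<close> those already present on their
    own. A member in both has \<open>w\<close> in the window of its color.\<close>
  define S1 S2 where "S1 = {U\<in>S. w < 2 * r * (real (?c U) + 1)}" and "S2 = {U\<in>S. 2 * r * real (?c U) \<le> w}"
  have fin12: "finite S1" "finite S2" using fin by (auto simp: S1_def S2_def)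
  have "card (S1 \<inter> S2) \<le> 1"
  proof -
    have "U = V" if UV: "U \<in> S1 \<inter> S2" "V \<in> S1 \<inter> S2" for U V
    proof -
      have "2 * r * real (?c U) < 2 * r * (real (?c V) + 1)" "2 * r * real (?c V) < 2 * r * (real (?c U) + 1)"
        using UV by (auto simp: S1_def S2_def)
      then have "real (?c U) < real (?c V) + 1" "real (?c V) < real (?c U) + 1"
        using r_pos by simp_all
      then have "?c U = ?c V" by linarith
      then show ?thesis using UV inj by (auto simp: S1_def inj_on_def)
    qed
    then show ?thesis using fin12 by (simp add: card_le_Suc0_iff_eq)
  qed
  moreover have "card (S1 \<union> S2) \<le> card S" using fin by (intro card_mono) (auto simp: S1_def S2_def)
  ultimately have card12: "card S1 + card S2 \<le> m + 2"
    using card_Un_Int[OF fin12] cardS by linarith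
  define W where "W = (\<lambda>U. layer_set k (\<rho> k U)) ` S1 \<union> layer_set (Suc k) ` S2"
  have sub: "{V\<in>layer_sets. x \<in> V} \<subseteq> W"
  proof
    fix V assume "V \<in> {V\<in>layer_sets. x \<in> V}"
    then obtain j U where V: "V = layer_set j U" "U \<in> \<U> j" "x \<in> layer_set j U"
      by (auto simp: layer_sets_def)
    from V(3) consider
        (lower) "b x \<in> U" "u x < real j * T" "j = 0 \<or> real j * T - T + 2 * r * real (col j U) \<le> u x"
      | (upper) U' where "real j * T \<le> u x" "U' \<in> \<U> (Suc j)" "\<rho> j U' = U" "b x \<in> U'"
          "u x < real j * T + 2 * r * (real (col (Suc j) U') + 1)"
      unfolding layer_set_def by blast
    then show "V \<in> W"
    proof cases
      \<comment> \<open>The lower part of a set of index \<open>j\<close> ends at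
        \<open>j * T\<close>, so at a nonnegative height \<open>j\<close> is a successor, and the
        level below it is the level of \<open>x\<close>.\<close>
      case lower
      then obtain i where i: "j = Suc i" using False by (cases j) auto
      have h: "real i * T + 2 * r * real (col j U) \<le> u x" "u x < real i * T + T"
        using lower i by (simp_all add: algebra_simps)
      moreover have "0 \<le> 2 * r * real (col j U)" using r_pos by simp
      ultimately have "i = k" by (intro level_unique[of i "u x" k]) (use k in linarith)+
      then have "U \<in> S2" using h lower V(2) i by (simp add: S2_def S_def w_def)
      then show ?thesis using V(1) i \<open>i = k\<close> by (simp add: W_def)
    next
      case upper
      have "j = k" using window_le[OF upper(2)] upper(1,5) k r_pos
        by (intro level_unique[of j "u x" k]) auto
      then have "U' \<in> S1" using upper by (simp add: S1_def S_def w_def)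
      then show ?thesis using V(1) upper(3) \<open>j = k\<close> by (auto simp: W_def)
    qed
  qed
  have "finite W" using fin12 by (simp add: W_def)
  moreover have "card W \<le> m + 2"
  proof -
    have "card W \<le> card ((\<lambda>U. layer_set k (\<rho> k U)) ` S1) + card (layer_set (Suc k) ` S2)"
      unfolding W_def by (rule card_Un_le)
    also have "\<dots> \<le> card S1 + card S2" using fin12 by (intro add_mono card_image_le)
    finally show ?thesis using card12 by simp
  qed
  ultimately show ?thesis using finite_subset[OF sub] card_mono[OF _ sub] by simp
qed

text \<open>\<open>B\<close> plays the role of a ball of radius \<open>r\<close> about a point of
  height \<open>t\<close>. Its heights span less than the window width \<open>2 * r\<close>, so it
  lies entirely below the top or entirely above the bottom of the window of a given color.\<close>

lemma layer_sets_lebesgue: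
  assumes B: "B \<subseteq> X" "\<And>y. y \<in> B \<Longrightarrow> \<bar>t - u y\<bar> < r"
    and proj: "\<And>k. real k * T - r \<le> t \<Longrightarrow> \<exists>U\<in>\<U> (Suc k). b ` B \<subseteq> U"
  shows "\<exists>V\<in>layer_sets. B \<subseteq> V"
proof (cases "t + r < 0")
  case True
  have "layer_set 0 Z \<in> layer_sets" using \<U>_0 by (auto simp: layer_sets_def)
  moreover have "B \<subseteq> layer_set 0 Z"
  proof
    fix y assume "y \<in> B"
    then have "y \<in> X" "u y < 0" using B(1) B(2)[of y] True by auto
    then show "y \<in> layer_set 0 Z" using base_mem by (simp add: layer_set_def)
  qed
  ultimately show ?thesis by blast
next
  case False
  \<comment> \<open>The level is taken at \<open>t + r\<close>, above all heights in
    \<open>B\<close>. Thus \<open>B\<close> stays below level \<open>k + 1\<close> and reaches less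
    than \<open>2 * r\<close> below level \<open>k\<close>.\<close>
  then obtain k where k: "real k * T \<le> t + r" "t + r < real k * T + T"
    using obtain_level[of "t + r"] by (metis not_less)
  then obtain U where U: "U \<in> \<U> (Suc k)" "b ` B \<subseteq> U" using proj[of k] by auto
  define c where "c = real (col (Suc k) U)"
  show ?thesis
  \<comment> \<open>The threshold is the midpoint of the window of the color of \<open>U\<close>:
    below it \<open>B\<close> fits into the merged set, otherwise into the set of \<open>U\<close>
    itself.\<close>
  proof (cases "t < real k * T + 2 * r * c + r")
    case True
    have "B \<subseteq> layer_set k (\<rho> k U)"
    proof
      fix y assume "y \<in> B"
      then have y: "y \<in> X" "b y \<in> U" "b y \<in> \<rho> k U" and h: "\<bar>t - u y\<bar> < r"
        using B U subset_\<rho>[OF U(1)] by auto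
      show "y \<in> layer_set k (\<rho> k U)"
      proof (cases "real k * T \<le> u y")
        case upper: True
        have "u y < real k * T + 2 * r * (c + 1)"
          using h True by (simp add: algebra_simps)
        then show ?thesis using y U(1) upper unfolding layer_set_def c_def by blast
      next
        \<comment> \<open>Here the spare window matters: at depth less than \<open>2 * r\<close>
          below level \<open>k\<close>, the transition of every color of \<open>\<U> k\<close> is
          already complete.\<close>
        case False
        have "real k * T - T + 2 * r * real (col k (\<rho> k U)) \<le> u y"
          using window_le[OF \<rho>_mem[OF U(1)]] h k by (simp add: algebra_simps)
        then show ?thesis using y False by (simp add: layer_set_def)
      qed
    qed
    then show ?thesis using \<rho>_mem[OF U(1)] by (auto simp: layer_sets_def)
  next
    case False
    have "B \<subseteq> layer_set (Suc k) U"
    proof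
      fix y assume "y \<in> B"
      then have y: "y \<in> X" "b y \<in> U" and h: "\<bar>t - u y\<bar> < r"
        using B U by auto
      have "u y < real k * T + T" "real k * T + 2 * r * c \<le> u y"
        using h False k by linarith+
      then show "y \<in> layer_set (Suc k) U"
        using y by (simp add: layer_set_def c_def algebra_simps)
    qed
    then show ?thesis using U(1) by (auto simp: layer_sets_def)
  qed
qed

end

section \<open>Covers of the cone\<close>

text \<open>A ball of radius \<open>l\<close> about any point of \<open>V\<close> contains
  \<open>V\<close>, because the diameter bound of the fine cover is below the Lebesgue number of the
  coarse one. For empty \<open>V\<close> a point of \<open>Z\<close> supplies some member.\<close>

lemma inscribed_member:
  assumes fine: "colored_cover Z m \<tau>' l' \<V> col'" and coarse: "colored_cover Z m \<tau> l \<U> col"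
    and "\<tau>' < l" "Z \<noteq> {}" "V \<in> \<V>"
  shows "\<exists>U\<in>\<U>. V \<subseteq> U"
proof -
  have leb: "\<exists>U\<in>\<U>. \<forall>w\<in>Z. dist z w < l \<longrightarrow> w \<in> U" if "z \<in> Z" for z
    using colored_coverD(5)[OF coarse that] .
  have V: "V \<subseteq> Z" "\<And>x y. \<lbrakk>x \<in> V; y \<in> V\<rbrakk> \<Longrightarrow> dist x y \<le> \<tau>'"
    using colored_coverD(1,3)[OF fine \<open>V \<in> \<V>\<close>] .
  show ?thesis
  proof (cases "V = {}")
    case True
    then show ?thesis using leb \<open>Z \<noteq> {}\<close> by blast
  next
    case False
    then obtain z where "z \<in> V" by blast
    then obtain U where U: "U \<in> \<U>" "\<And>w. \<lbrakk>w \<in> Z; dist z w < l\<rbrakk> \<Longrightarrow> w \<in> U"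
      using leb V(1) by blast
    have "w \<in> U" if "w \<in> V" for w
      using U(2)[of w] V(1) V(2)[OF \<open>z \<in> V\<close> that] that \<open>\<tau>' < l\<close> by auto
    then show ?thesis using U(1) by blast
  qed
qed

lemma asdim_le_cone:
  fixes Z :: "'a::metric_space set"
  assumes bounded: "bounded Z" and c_cap: "0 < c_cap Z m"
  shows "asdim_le (cone_carrier Z) (cone_dist Z) (m + 1)"
proof -
  obtain \<tau>0 c where \<tau>0: "0 < \<tau>0" and c: "0 < c"
    and covers: "\<And>\<tau>. 0 < \<tau> \<Longrightarrow> \<tau> \<le> \<tau>0 \<Longrightarrow> \<exists>\<U> col. colored_cover Z m \<tau> (c * \<tau>) \<U> col"
    and "bounded Z \<Longrightarrow> 0 < diameter Z"
    using small_scale_covers[OF c_cap] by blast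
  \<comment> \<open>A one-point space has no covering of mesh at least
    \<open>\<delta> * \<tau> > 0\<close>, so the cone is nondegenerate and \<open>cone_mu Z\<close>
    is \<open>pi / diameter Z\<close>.\<close>
  then have diam: "0 < diameter Z" using bounded by simp
  note ne = cone_nonempty[OF bounded diam]
  note mu = cone_mu_pos[OF bounded diam]
  note base = cone_base_mem[OF ne]
  show ?thesis
  proof (rule asdim_le_if_lebesgue_covers)
    fix r :: real assume "0 < r"
    \<comment> \<open>The first summand of \<open>T\<close> makes room for the color windows;
      \<open>1 / c\<close> ensures \<open>exp (- T) < c\<close>, so consecutive covers refine each
      other. \<open>A\<close> makes \<open>c * \<sigma> k\<close> equal the base distance bound at
      height \<open>t0 + k * T - 2 * r\<close>. In \<open>t0\<close>, the part
      \<open>2 * r + 1\<close> keeps this height at least 1 and \<open>A / \<tau>0\<close> brings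
      all scales below \<open>\<tau>0\<close>.\<close>
    define T where "T = 2 * r * (real m + 2) + 1 / c"
    define A where "A = 24 * sinh (r / 2) / cone_mu Z * exp (2 * r) / c"
    define t0 where "t0 = 2 * r + 1 + A / \<tau>0"
    have "0 < A" using \<open>0 < r\<close> mu c by (simp add: A_def)
    have "0 < T" using \<open>0 < r\<close> c by (simp add: T_def add_pos_pos)
    have t0: "2 * r + 1 \<le> t0" using \<open>0 < A\<close> \<tau>0 by (simp add: t0_def)
    define \<sigma> where "\<sigma> k = A * exp (- t0 - real k * T)" for k
    have \<sigma>_pos: "0 < \<sigma> k" for k using \<open>0 < A\<close> by (simp add: \<sigma>_def)
    have \<sigma>_le: "\<sigma> k \<le> \<tau>0" for k
    proof -
      have "A / \<tau>0 \<le> exp t0"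
        using exp_ge_add_one_self[of t0] \<open>0 < r\<close> by (simp add: t0_def)
      then have "A * exp (- t0) \<le> \<tau>0" using \<tau>0 by (simp add: exp_minus field_simps)
      moreover have "\<sigma> k \<le> A * exp (- t0)"
        unfolding \<sigma>_def using \<open>0 < A\<close> \<open>0 < T\<close> by (intro mult_left_mono) auto
      ultimately show ?thesis by linarith
    qed
    have \<sigma>_Suc: "\<sigma> (Suc k) < c * \<sigma> k" for k
    proof -
      have "0 < 2 * r * (real m + 2)" using \<open>0 < r\<close> by (intro mult_pos_pos) auto
      then have "1 / c < T" by (simp add: T_def)
      then have "1 / c < exp T" using exp_ge_add_one_self[of T] by linarith
      then have "exp (- T) < c" using c by (simp add: exp_minus field_simps)
      moreover have "\<sigma> (Suc k) = exp (- T) * \<sigma> k"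
        by (simp add: \<sigma>_def exp_add[symmetric] algebra_simps)
      ultimately show ?thesis using \<sigma>_pos by simp
    qed
    obtain \<W> \<kappa> where \<W>: "\<And>k. colored_cover Z m (\<sigma> k) (c * \<sigma> k) (\<W> k) (\<kappa> k)"
      using covers[OF \<sigma>_pos \<sigma>_le] by metis
    \<comment> \<open>The index shifts by one: level 0 is the trivial cover for the core, and
      \<open>\<U> (Suc k)\<close> has scale \<open>\<sigma> k\<close>, matched to height
      \<open>t0 + k * T\<close>.\<close>
    define \<U> where "\<U> k = (case k of 0 \<Rightarrow> {Z} | Suc j \<Rightarrow> \<W> j)" for k
    define col where "col k U = (case k of 0 \<Rightarrow> 0 | Suc j \<Rightarrow> \<kappa> j U)" for k U
    have \<U>_simps: "\<U> 0 = {Z}" "\<U> (Suc j) = \<W> j" for j by (simp_all add: \<U>_def)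
    have inscribed: "\<exists>U\<in>\<U> k. V \<subseteq> U" if "V \<in> \<U> (Suc k)" for k V
    proof (cases k)
      case 0
      then have "V \<in> \<W> 0" using that by (simp add: \<U>_simps)
      then have "V \<subseteq> Z" by (rule colored_coverD(1)[OF \<W>])
      then show ?thesis using 0 by (simp add: \<U>_simps)
    next
      case (Suc j)
      then have "V \<in> \<W> (Suc j)" using that by (simp add: \<U>_simps)
      then show ?thesis
        unfolding Suc \<U>_simps by (rule inscribed_member[OF \<W> \<W> \<sigma>_Suc ne])
    qed
    define \<rho> where "\<rho> k V = (SOME U. U \<in> \<U> k \<and> V \<subseteq> U)" for k V
    have \<rho>: "\<rho> k V \<in> \<U> k \<and> V \<subseteq> \<rho> k V" if "V \<in> \<U> (Suc k)" for k V
      using someI_ex[of "\<lambda>U. U \<in> \<U> k \<and> V \<subseteq> U"] inscribed[OF that] unfolding \<rho>_def by blast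
    define u where "u x = cone_height x - t0" for x :: "('a \<times> real) option"
    interpret layered_cover "cone_carrier Z" "cone_base Z" u Z \<U> col \<rho> m r T
    proof
      show "col k U \<le> m" if "U \<in> \<U> k" for k U
      proof (cases k)
        case (Suc j)
        then have "U \<in> \<W> j" using that by (simp add: \<U>_simps)
        then show ?thesis using colored_coverD(2)[OF \<W>] Suc by (simp add: col_def)
      qed (simp add: col_def)
      show "U = V" if "U \<in> \<U> k" "V \<in> \<U> k" "col k U = col k V" "z \<in> U" "z \<in> V" for k U V z
      proof (cases k)
        case (Suc j)
        then have "U \<in> \<W> j" "V \<in> \<W> j" "\<kappa> j U = \<kappa> j V"
          using that by (simp_all add: \<U>_def col_def)
        then show ?thesis using that(4,5) by (rule colored_coverD(4)[OF \<W>])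
      qed (use that in \<open>simp add: \<U>_simps\<close>)
    qed (use \<open>0 < r\<close> c \<rho> base in \<open>auto simp: T_def \<U>_simps\<close>)
    have lebesgue: "\<exists>V\<in>layer_sets. \<forall>y\<in>cone_carrier Z. cone_dist Z x y < r \<longrightarrow> y \<in> V"
      if x: "x \<in> cone_carrier Z" for x
    proof -
      define B where "B = {y\<in>cone_carrier Z. cone_dist Z x y < r}"
      have h: "\<bar>u x - u y\<bar> < r" if "y \<in> B" for y
        using cone_height_diff_le[OF bounded diam x, of y] that by (simp add: B_def u_def)
      have "\<exists>U\<in>\<U> (Suc k). cone_base Z ` B \<subseteq> U" if k: "real k * T - r \<le> u x" for k
      proof -
        obtain U where U: "U \<in> \<W> k"
            "\<And>w. \<lbrakk>w \<in> Z; dist (cone_base Z x) w < c * \<sigma> k\<rbrakk> \<Longrightarrow> w \<in> U"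
          using colored_coverD(5)[OF \<W> base[OF x]] by blast
        \<comment> \<open>The point \<open>x\<close> may lie \<open>r\<close> below height
          \<open>t0 + k * T\<close>, and points of its ball another \<open>r\<close> lower, so
          \<open>s\<close> bounds all their heights from below.\<close>
        define s where "s = t0 + real k * T - 2 * r"
        have "0 \<le> real k * T" using \<open>0 < T\<close> by simp
        then have s: "1 \<le> s" "s + r \<le> cone_height x"
          using t0 k by (simp_all add: s_def u_def)
        have "cone_base Z y \<in> U" if y: "y \<in> B" for y
        proof (rule U(2))
          have yX: "y \<in> cone_carrier Z" "cone_dist Z x y < r" using y by (auto simp: B_def)
          have "s \<le> cone_height y" using h[OF y] s(2) by (simp add: u_def)
          then have "dist (cone_base Z x) (cone_base Z y) < 24 * sinh (r / 2) / cone_mu Z * exp (- s)"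
            using dist_cone_base_less[OF bounded diam x yX(1) s(1) _ _ yX(2)] s(2) \<open>0 < r\<close> by simp
          also have "\<dots> = c * \<sigma> k"
            using c by (simp add: \<sigma>_def A_def s_def exp_add[symmetric] algebra_simps)
          finally show "dist (cone_base Z x) (cone_base Z y) < c * \<sigma> k" .
          show "cone_base Z y \<in> Z" using base yX(1) .
        qed
        then show ?thesis using U(1) by (auto simp: \<U>_simps)
      qed
      then have "\<exists>V\<in>layer_sets. B \<subseteq> V"
        using h by (intro layer_sets_lebesgue[of B "u x"]) (auto simp: B_def)
      then show ?thesis unfolding B_def by blast
    qed
    \<comment> \<open>\<open>C\<close> satisfies
      \<open>cone_mu Z * \<sigma> j = C * exp (- H)\<close>, with \<open>H\<close> the greatest
      height reached by a layer set of index \<open>Suc j\<close>, and does not depend on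
      \<open>j\<close>. In \<open>D\<close> the first bound serves the core, the second all other
      layer sets.\<close>
    define C where "C = cone_mu Z * A * exp (2 * T)"
    define D where "D = max (2 * (t0 + T)) (2 * arsinh (sinh T + C))"
    have bdd: "cone_dist Z x y \<le> D"
      if V: "V \<in> layer_sets" and x: "x \<in> cone_carrier Z" "x \<in> V" and y: "y \<in> cone_carrier Z" "y \<in> V"
      for V x y
    proof -
      obtain k U where kU: "V = layer_set k U" "U \<in> \<U> k" using V by (auto simp: layer_sets_def)
      note hx = layer_set_height[OF kU(2) x(2)[unfolded kU(1)]]
      note hy = layer_set_height[OF kU(2) y(2)[unfolded kU(1)]]
      show ?thesis
      proof (cases k)
        case 0
        then have "cone_height x \<le> t0 + T" "cone_height y \<le> t0 + T"
          using hx(2) hy(2) by (simp_all add: u_def)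
        then show ?thesis
          using cone_dist_le_height_add[OF bounded diam x(1) y(1)] by (simp add: D_def)
      next
        case (Suc j)
        define H where "H = t0 + real j * T + 2 * T"
        have H: "cone_height x \<le> H" "cone_height y \<le> H" "H - 2 * T \<le> cone_height x" "H - 2 * T \<le> cone_height y"
          using hx(2,3) hy(2,3) Suc by (simp_all add: u_def H_def algebra_simps)
        have "dist (cone_base Z x) (cone_base Z y) \<le> \<sigma> j"
          using hx(1) hy(1) kU(2) Suc by (intro colored_coverD(3)[OF \<W>]) (simp_all add: \<U>_simps)
        then have "cone_mu Z * dist (cone_base Z x) (cone_base Z y) \<le> cone_mu Z * \<sigma> j"
          using mu by simp
        also have "\<dots> = C * exp (- H)"
          by (simp add: C_def \<sigma>_def H_def exp_add[symmetric] algebra_simps)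
        finally have "cone_dist Z x y \<le> 2 * arsinh (sinh T + C)"
          using H by (intro cone_dist_le_if_base_close[OF bounded diam x(1) y(1) _ H(1,2)]) linarith
        then show ?thesis by (simp add: D_def)
      qed
    qed
    show "\<exists>\<V> D. (\<forall>x\<in>cone_carrier Z. finite {V\<in>\<V>. x \<in> V} \<and> card {V\<in>\<V>. x \<in> V} \<le> m + 1 + 1) \<and>
        (\<forall>V\<in>\<V>. \<forall>x\<in>cone_carrier Z. \<forall>y\<in>cone_carrier Z. x \<in> V \<and> y \<in> V \<longrightarrow> cone_dist Z x y \<le> D) \<and>
        (\<forall>x\<in>cone_carrier Z. \<exists>V\<in>\<V>. \<forall>y\<in>cone_carrier Z. cone_dist Z x y < r \<longrightarrow> y \<in> V)"
      using layer_sets_multiplicity bdd lebesgue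
      by (intro exI[of _ layer_sets] exI[of _ D]) simp
  qed (rule cone_dist_nonneg[OF bounded diam] cone_dist_commute[OF bounded diam]
      cone_dist_self[OF bounded diam] cone_dist_triangle[OF bounded diam]; assumption)+
qed

section \<open>Comparison of the two dimensions\<close>

theorem theorem5p1:
  fixes Z :: "'a::metric_space set"
  assumes "bounded Z"
  shows "asdim (cone_carrier Z) (cone_dist Z) \<le> cdim Z + 1"
proof (cases "\<exists>m. 0 < c_cap Z m")
  case True
  then obtain m0 where "0 < c_cap Z m0" by blast
  \<comment> \<open>By well-ordering of \<open>enat\<close> the infimum of this nonempty set is
    attained, so \<open>cdim Z\<close> itself has positive capacity.\<close>
  then have "cdim Z \<in> {enat m | m. 0 < c_cap Z m}"
    unfolding cdim_def by (intro wellorder_InfI[of "enat m0"]) auto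
  then obtain m where m: "cdim Z = enat m" "0 < c_cap Z m" by blast
  have "asdim (cone_carrier Z) (cone_dist Z) \<le> enat (m + 1)"
    unfolding asdim_def using asdim_le_cone[OF assms m(2)] by (intro Inf_lower) blast
  then show ?thesis by (simp add: m(1) one_enat_def)
next
  case False
  \<comment> \<open>The infimum of the empty set is infinite in \<open>enat\<close>.\<close>
  then have "cdim Z = \<infinity>" by (simp add: cdim_def Inf_enat_def)
  then show ?thesis by simp
qed

end
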